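(* Let $l>0$, $\Delta>0$, $\overline{v}>0$, $\overline{\omega^s}>0$. For every $\eta=[\eta_1,\eta_2]^T\in\mathbb{R}\times(-\pi/2,\pi/2)$ let $M(\eta)$, $T$, $h$ be as defined in the context and let $$\mathcal{U}(\eta)=\{w\in\mathbb{R}^2:\ L(\eta)w\le h\},\qquad L(\eta)=T\,M^{-1}(\eta).$$ Then, for each $\eta$, the polyhedral set $\mathcal{U}(\eta)$ is a parallelogram (varying with $\eta$), and the family admits the following worst-case circular inner approximation: $$\hat{\mathcal{U}}:=\bigcap_{\eta\in\mathbb{R}\times(-\pi/2,\pi/2)}\mathcal{U}(\eta)=\{w\in\mathbb{R}^2:\ w^Tw\le \hat r^2\},\qquad \hat r=\min\left(\frac{\Delta\, l\,\overline{\omega^s}}{\sqrt{\Delta^2+l^2}},\ \overline{v}\right).$$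
   Context: The car-like vehicle has heading angle $\eta_1=\theta$, steering angle $\eta_2=\varphi$, wheelbase $l>0$, and inputs $u=[v,\omega^s]^T$ (longitudinal velocity and steering angular velocity) with box constraints $Tu\le h$ (componentwise), i.e. $|v|\le\overline v$, $|\omega^s|\le\overline{\omega^s}$, where $$T=\begin{bmatrix}-1&0\\0&-1\\1&0\\0&1\end{bmatrix},\qquad h=\begin{bmatrix}\overline v\\ \overline{\omega^s}\\ \overline v\\ \overline{\omega^s}\end{bmatrix}.$$ The input transformation of the input-output feedback linearization is $w=M(\eta)u$ with $$M(\eta)=\begin{bmatrix}\cos\eta_1-\tan\eta_2\left(\sin\eta_1+\frac{\Delta}{l}\sin(\eta_1+\eta_2)\right)&-\Delta\sin(\eta_1+\eta_2)\\ \sin\eta_1+\tan\eta_2\left(\cos\eta_1+\frac{\Delta}{l}\cos(\eta_1+\eta_2)\right)&\Delta\cos(\eta_1+\eta_2)\end{bmatrix},$$ where $\Delta>0$ is a design parameter; $M(\eta)$ is defined and invertible for $\eta_2\in(-\pi/2,\pi/2)$. *)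

theory Defs
  imports "HOL-Analysis.Analysis"
begin

definition eta_dom :: "(real^2) set" where
  "eta_dom = {\<eta>. \<eta>$2 \<in> {-(pi/2)<..<pi/2}}"

definition M_mat :: "real \<Rightarrow> real \<Rightarrow> real^2 \<Rightarrow> real^2^2" where
  "M_mat l \<Delta> \<eta> = vector [
     vector [cos (\<eta>$1) - tan (\<eta>$2) * (sin (\<eta>$1) + \<Delta> / l * sin (\<eta>$1 + \<eta>$2)),
             - \<Delta> * sin (\<eta>$1 + \<eta>$2)],
     vector [sin (\<eta>$1) + tan (\<eta>$2) * (cos (\<eta>$1) + \<Delta> / l * cos (\<eta>$1 + \<eta>$2)),
             \<Delta> * cos (\<eta>$1 + \<eta>$2)]]"

definition T_mat :: "real^2^4" where
  "T_mat = vector [vector [-1, 0], vector [0, -1], vector [1, 0], vector [0, 1]]"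

definition h_vec :: "real \<Rightarrow> real \<Rightarrow> real^4" where
  "h_vec vbar \<omega>bar = vector [vbar, \<omega>bar, vbar, \<omega>bar]"

definition L_mat :: "real \<Rightarrow> real \<Rightarrow> real^2 \<Rightarrow> real^2^4" where
  "L_mat l \<Delta> \<eta> = T_mat ** matrix_inv (M_mat l \<Delta> \<eta>)"

(* The order on real^4 is the componentwise one. *)
definition U_set :: "real \<Rightarrow> real \<Rightarrow> real \<Rightarrow> real \<Rightarrow> real^2 \<Rightarrow> (real^2) set" where
  "U_set l \<Delta> vbar \<omega>bar \<eta> = {w. L_mat l \<Delta> \<eta> *v w \<le> h_vec vbar \<omega>bar}"

(* Solid and nondegenerate; a \<noteq> b is needed because {a, b} collapses when a = b. *)
definition parallelogram :: "'a::real_vector set \<Rightarrow> bool" where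
  "parallelogram P \<longleftrightarrow> (\<exists>p a b. a \<noteq> b \<and> independent {a, b} \<and>
     P = convex hull {p, p + a, p + a + b, p + b})"

(* On eta_dom the inverse in L_mat is a genuine one. *)
lemma det_M_mat:
  assumes "\<eta> \<in> eta_dom"
  shows "det (M_mat l \<Delta> \<eta>) = \<Delta> / cos (\<eta>$2)"
proof -
  have c: "cos (\<eta>$2) > 0"
    using assms by (auto simp: eta_dom_def intro: cos_gt_zero_pi)
  have s2: "sin (\<eta>$2) * sin (\<eta>$2) = 1 - cos (\<eta>$2) * cos (\<eta>$2)"
    by (simp add: sin_squared_eq flip: power2_eq_square)
  have p: "cos (\<eta>$1) * cos (\<eta>$1 + \<eta>$2) + sin (\<eta>$1) * sin (\<eta>$1 + \<eta>$2) = cos (\<eta>$2)"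
    using cos_diff[of "\<eta>$1 + \<eta>$2" "\<eta>$1"] by (simp add: algebra_simps)
  have q: "cos (\<eta>$1) * sin (\<eta>$1 + \<eta>$2) - sin (\<eta>$1) * cos (\<eta>$1 + \<eta>$2) = sin (\<eta>$2)"
    using sin_diff[of "\<eta>$1 + \<eta>$2" "\<eta>$1"] by (simp add: algebra_simps)
  have "det (M_mat l \<Delta> \<eta>)
      = \<Delta> * (cos (\<eta>$1) * cos (\<eta>$1 + \<eta>$2) + sin (\<eta>$1) * sin (\<eta>$1 + \<eta>$2))
        + \<Delta> * tan (\<eta>$2) * (cos (\<eta>$1) * sin (\<eta>$1 + \<eta>$2) - sin (\<eta>$1) * cos (\<eta>$1 + \<eta>$2))"
    unfolding det_2 M_mat_def vector_2 by (simp only: algebra_simps)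
  also have "\<dots> = \<Delta> * cos (\<eta>$2) + \<Delta> * tan (\<eta>$2) * sin (\<eta>$2)"
    unfolding p q ..
  also have "\<dots> = \<Delta> / cos (\<eta>$2)"
    using c by (simp add: tan_def field_simps s2)
  finally show ?thesis .
qed

lemma invertible_M_mat:
  assumes "\<eta> \<in> eta_dom" "\<Delta> > 0"
  shows "invertible (M_mat l \<Delta> \<eta>)"
proof -
  have "cos (\<eta>$2) > 0"
    using assms by (auto simp: eta_dom_def intro: cos_gt_zero_pi)
  then show ?thesis
    using assms by (simp add: invertible_det_nz det_M_mat)
qed

end

theory Submission
  imports Defs
begin

text \<open>In the coordinates of \<open>w\<close> along and across the direction \<open>\<eta>\<^sub>1 + \<eta>\<^sub>2\<close>, the rows of the inverse of
  \<open>M(\<eta>)\<close> have norms \<open>cos \<eta>\<^sub>2\<close> and \<open>sqrt (1/\<Delta>\<^sup>2 + sin\<^sup>2 \<eta>\<^sub>2/l\<^sup>2)\<close>. By Cauchy-Schwarz each constraint strip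
  contains the disc, and as \<open>\<eta>\<^sub>1\<close> is free the normal of either strip can be turned towards any
  given \<open>w\<close>. The first norm is largest at \<open>\<eta>\<^sub>2 = 0\<close>; the supremum of the second is only approached,
  for \<open>\<eta>\<^sub>2\<close> tending to \<open>pi/2\<close>.\<close>

section \<open>Parallelograms as affine images of the unit square\<close>

text \<open>The right-hand side is a translated linear image of the unit square, hence convex.
  Conversely, its points arise by interpolating twice: along the two sides parallel to
  \<open>a\<close>, then between the points found there.\<close>

lemma convex_hull_parallelogram:
  fixes p a b :: "'a::real_vector"
  shows "convex hull {p, p + a, p + a + b, p + b}
       = {p + s *\<^sub>R a + t *\<^sub>R b | s t. s \<in> {0..1} \<and> t \<in> {0..1}}" (is "?H = ?P")
proof (rule subset_antisym)
  have eq: "?P = (\<lambda>x. p + x) ` ((\<lambda>(s, t). s *\<^sub>R a + t *\<^sub>R b) ` ({0..1} \<times> {0..1}))"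
    by (force simp: image_iff add.assoc)
  have lin: "linear (\<lambda>(s, t). s *\<^sub>R a + t *\<^sub>R b)"
    by (rule linearI) (auto simp: algebra_simps)
  have conv: "convex ?P"
    unfolding eq by (intro convex_translation convex_linear_image[OF lin] convex_Times) auto
  show "?H \<subseteq> ?P"
  proof (rule hull_minimal)
    have "p + s *\<^sub>R a + t *\<^sub>R b \<in> ?P" if "s \<in> {0, 1}" "t \<in> {0, 1}" for s t :: real
      using that by fastforce
    from this[of 0 0] this[of 1 0] this[of 1 1] this[of 0 1]
    show "{p, p + a, p + a + b, p + b} \<subseteq> ?P" by simp
  qed (rule conv)
  show "?P \<subseteq> ?H"
  proof
    fix x assume "x \<in> ?P"
    then obtain s t where x: "x = p + s *\<^sub>R a + t *\<^sub>R b" and st: "s \<in> {0..1}" "t \<in> {0..1}"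
      by blast
    have "{p, p + a, p + a + b, p + b} \<subseteq> ?H"
      by (rule hull_subset)
    \<comment> \<open>The points at parameter \<open>s\<close> on two opposite sides.\<close>
    then have "(1 - s) *\<^sub>R p + s *\<^sub>R (p + a) \<in> ?H" "(1 - s) *\<^sub>R (p + b) + s *\<^sub>R (p + a + b) \<in> ?H"
      using st by (simp_all add: convexD[OF convex_convex_hull])
    then have "(1 - t) *\<^sub>R ((1 - s) *\<^sub>R p + s *\<^sub>R (p + a))
             + t *\<^sub>R ((1 - s) *\<^sub>R (p + b) + s *\<^sub>R (p + a + b)) \<in> ?H"
      using st by - (rule convexD[OF convex_convex_hull]; (assumption | simp))
    also have "(1 - t) *\<^sub>R ((1 - s) *\<^sub>R p + s *\<^sub>R (p + a))
             + t *\<^sub>R ((1 - s) *\<^sub>R (p + b) + s *\<^sub>R (p + a + b)) = x"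
      unfolding x by (simp add: algebra_simps)
    finally show "x \<in> ?H" .
  qed
qed

lemma parallelogram_imp_polyhedron:
  fixes P :: "'a::euclidean_space set"
  assumes "parallelogram P"
  shows "polyhedron P"
  using assms by (auto simp: parallelogram_def intro!: polyhedron_convex_hull)

section \<open>Vectors and matrices in coordinates\<close>

lemma vec2_eq_iff:
  fixes x y :: "'a^2"
  shows "x = y \<longleftrightarrow> x$1 = y$1 \<and> x$2 = y$2"
  by (simp add: vec_eq_iff forall_2)

lemma power2_norm_vec2:
  fixes x :: "real^2"
  shows "(norm x)\<^sup>2 = (x$1)\<^sup>2 + (x$2)\<^sup>2"
  unfolding power2_norm_eq_inner by (simp add: inner_vec_def sum_2 power2_eq_square)

lemma matrix_inv_vector_mult_cancel:
  fixes A :: "real^'n^'n"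
  assumes "invertible A"
  shows "A *v (matrix_inv A *v x) = x" "matrix_inv A *v (A *v x) = x"
proof -
  have "A ** matrix_inv A = mat 1 \<and> matrix_inv A ** A = mat 1"
    using assms unfolding invertible_def matrix_inv_def by (rule someI_ex)
  then show "A *v (matrix_inv A *v x) = x" "matrix_inv A *v (A *v x) = x"
    by (simp_all add: matrix_vector_mul_assoc)
qed

lemma vector_4:
  "(vector [w, x, y, z] :: 'a::zero^4) $ 1 = w"
  "(vector [w, x, y, z] :: 'a::zero^4) $ 2 = x"
  "(vector [w, x, y, z] :: 'a::zero^4) $ 3 = y"
  "(vector [w, x, y, z] :: 'a::zero^4) $ 4 = z"
  unfolding vector_def by simp_all

section \<open>The constraints in the rotated frame\<close>

lemma T_mat_le_h_vec_iff:
  "T_mat *v u \<le> h_vec a b \<longleftrightarrow> \<bar>u$1\<bar> \<le> a \<and> \<bar>u$2\<bar> \<le> b"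
  by (auto simp: T_mat_def h_vec_def less_eq_vec_def forall_4 vector_4
      matrix_vector_mult_def sum_2)

lemma mem_U_set_iff_matrix_inv:
  "w \<in> U_set l \<Delta> vbar \<omega>bar \<eta> \<longleftrightarrow>
    \<bar>(matrix_inv (M_mat l \<Delta> \<eta>) *v w) $ 1\<bar> \<le> vbar \<and> \<bar>(matrix_inv (M_mat l \<Delta> \<eta>) *v w) $ 2\<bar> \<le> \<omega>bar"
  by (simp add: U_set_def L_mat_def T_mat_le_h_vec_iff flip: matrix_vector_mul_assoc)

text \<open>In the frame turned by \<open>\<eta>$1 + \<eta>$2\<close> the system
  \<open>w = M u\<close> becomes triangular: the coordinate along is
  \<open>u$1 / cos (\<eta>$2)\<close>, and \<open>u$2\<close> enters only the coordinate across.
  Back substitution gives \<open>u\<close> without computing the inverse entry by entry.\<close>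

lemma mem_U_set_iff:
  assumes \<eta>: "\<eta> \<in> eta_dom" and "\<Delta> > 0"
  shows "w \<in> U_set l \<Delta> vbar \<omega>bar \<eta> \<longleftrightarrow>
    \<bar>cos (\<eta>$2) * (cos (\<eta>$1 + \<eta>$2) * w$1 + sin (\<eta>$1 + \<eta>$2) * w$2)\<bar> \<le> vbar \<and>
    \<bar>(cos (\<eta>$1 + \<eta>$2) * w$2 - sin (\<eta>$1 + \<eta>$2) * w$1) / \<Delta>
      - sin (\<eta>$2) / l * (cos (\<eta>$1 + \<eta>$2) * w$1 + sin (\<eta>$1 + \<eta>$2) * w$2)\<bar> \<le> \<omega>bar"
proof -
  define u where "u = matrix_inv (M_mat l \<Delta> \<eta>) *v w"
  define \<alpha> where "\<alpha> = \<eta>$1 + \<eta>$2"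
  define \<theta> where "\<theta> = \<eta>$1"
  define \<phi> where "\<phi> = \<eta>$2"
  have c: "cos \<phi> > 0"
    using \<eta> by (auto simp: eta_dom_def \<phi>_def intro: cos_gt_zero_pi)
  have w: "w = M_mat l \<Delta> \<eta> *v u"
    unfolding u_def using invertible_M_mat[OF assms] by (simp add: matrix_inv_vector_mult_cancel)
  have w1: "w$1 = (cos \<theta> - tan \<phi> * (sin \<theta> + \<Delta> / l * sin \<alpha>)) * u$1 - \<Delta> * sin \<alpha> * u$2"
    and w2: "w$2 = (sin \<theta> + tan \<phi> * (cos \<theta> + \<Delta> / l * cos \<alpha>)) * u$1 + \<Delta> * cos \<alpha> * u$2"
    unfolding w by (simp_all add: M_mat_def matrix_vector_mult_def sum_2 \<alpha>_def \<theta>_def \<phi>_def)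
  have p: "cos \<alpha> * cos \<theta> + sin \<alpha> * sin \<theta> = cos \<phi>"
    using cos_diff[of \<alpha> \<theta>] by (simp add: \<alpha>_def \<theta>_def \<phi>_def)
  have q: "sin \<alpha> * cos \<theta> - cos \<alpha> * sin \<theta> = sin \<phi>"
    using sin_diff[of \<alpha> \<theta>] by (simp add: \<alpha>_def \<theta>_def \<phi>_def)
  have r: "sin \<alpha> * sin \<alpha> + cos \<alpha> * cos \<alpha> = 1"
    using sin_cos_squared_add[of \<alpha>] by (simp add: power2_eq_square)
  \<comment> \<open>The terms in \<open>\<Delta>\<close> are purely across and cancel here. The rest
    is grouped so that \<open>p\<close> and \<open>q\<close> apply.\<close>
  have "cos \<alpha> * w$1 + sin \<alpha> * w$2
      = ((cos \<alpha> * cos \<theta> + sin \<alpha> * sin \<theta>) + tan \<phi> * (sin \<alpha> * cos \<theta> - cos \<alpha> * sin \<theta>)) * u$1"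
    unfolding w1 w2 by (simp add: algebra_simps)
  also have "\<dots> = u$1 / cos \<phi>"
    unfolding p q using c sin_cos_squared_add[of \<phi>]
    by (simp add: tan_def field_simps power2_eq_square flip: distrib_right distrib_left)
  finally have along: "cos \<alpha> * w$1 + sin \<alpha> * w$2 = u$1 / cos \<phi>" .
  have "cos \<alpha> * w$2 - sin \<alpha> * w$1
      = (tan \<phi> * (cos \<alpha> * cos \<theta> + sin \<alpha> * sin \<theta>) - (sin \<alpha> * cos \<theta> - cos \<alpha> * sin \<theta>)) * u$1
        + (sin \<alpha> * sin \<alpha> + cos \<alpha> * cos \<alpha>) * (tan \<phi> * (\<Delta> / l) * u$1 + \<Delta> * u$2)"
    unfolding w1 w2 by (simp only: algebra_simps)
  also have "\<dots> = tan \<phi> * (\<Delta> / l) * u$1 + \<Delta> * u$2"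
    unfolding p q r using c by (simp add: tan_def)
  finally have across: "cos \<alpha> * w$2 - sin \<alpha> * w$1 = tan \<phi> * (\<Delta> / l) * u$1 + \<Delta> * u$2" .
  have "cos \<phi> * (cos \<alpha> * w$1 + sin \<alpha> * w$2) = u$1"
    unfolding along using c by simp
  moreover have "(cos \<alpha> * w$2 - sin \<alpha> * w$1) / \<Delta> - sin \<phi> / l * (cos \<alpha> * w$1 + sin \<alpha> * w$2) = u$2"
    unfolding along across using c \<open>\<Delta> > 0\<close> by (simp add: tan_def add_divide_distrib)
  ultimately show ?thesis
    unfolding mem_U_set_iff_matrix_inv by (simp add: u_def \<alpha>_def \<phi>_def)
qed

section \<open>The shape of the sets and its dependence on the angles\<close>

text \<open>The invertible map \<open>M\<close> carries the box of admissible inputs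
  \<open>u\<close> onto the set, so corner and edges are images of those of the box, and injectivity
  keeps the edges independent.\<close>

lemma parallelogram_U_set:
  assumes "\<eta> \<in> eta_dom" "\<Delta> > 0" "vbar > 0" "\<omega>bar > 0"
  shows "parallelogram (U_set l \<Delta> vbar \<omega>bar \<eta>)"
proof -
  define M where "M = M_mat l \<Delta> \<eta>"
  have inv: "invertible M"
    unfolding M_def using assms by (simp add: invertible_M_mat)
  have inj: "inj ((*v) M)"
    by (metis injI inv matrix_inv_vector_mult_cancel(2))
  \<comment> \<open>\<open>e\<close> and \<open>f\<close> are the edges of the input box, and
    \<open>o'\<close> is its lower left corner.\<close>
  define e f :: "real^2" where "e = vector [2 * vbar, 0]" and "f = vector [0, 2 * \<omega>bar]"
  define o' :: "real^2" where "o' = vector [- vbar, - \<omega>bar]"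
  have "e \<noteq> f" "e \<noteq> 0" "f \<noteq> 0" "orthogonal e f"
    using assms by (simp_all add: vec2_eq_iff e_def f_def orthogonal_def inner_vec_def sum_2)
  then have ind: "independent {e, f}"
    by (intro pairwise_orthogonal_independent) (auto simp: pairwise_def orthogonal_commute)
  have "U_set l \<Delta> vbar \<omega>bar \<eta>
      = {M *v o' + s *\<^sub>R (M *v e) + t *\<^sub>R (M *v f) | s t. s \<in> {0..1} \<and> t \<in> {0..1}}" (is "_ = ?P")
  proof (intro set_eqI iffI)
    fix w assume w: "w \<in> U_set l \<Delta> vbar \<omega>bar \<eta>"
    define u where "u = matrix_inv M *v w"
    have u: "\<bar>u$1\<bar> \<le> vbar" "\<bar>u$2\<bar> \<le> \<omega>bar"
      using w by (simp_all add: mem_U_set_iff_matrix_inv u_def M_def)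
    define s t where "s = (u$1 + vbar) / (2 * vbar)" and "t = (u$2 + \<omega>bar) / (2 * \<omega>bar)"
    have st: "s \<in> {0..1}" "t \<in> {0..1}"
      using u assms by (auto simp: s_def t_def field_simps)
    have "u = o' + s *\<^sub>R e + t *\<^sub>R f"
      using assms by (simp add: vec2_eq_iff o'_def e_def f_def s_def t_def)
    moreover have "w = M *v u"
      using inv by (simp add: u_def matrix_inv_vector_mult_cancel)
    ultimately have "w = M *v o' + s *\<^sub>R (M *v e) + t *\<^sub>R (M *v f)"
      by (simp add: matrix_vector_right_distrib matrix_vector_mult_scaleR)
    with st show "w \<in> ?P" by blast
  next
    fix w assume "w \<in> ?P"
    then obtain s t where w: "w = M *v o' + s *\<^sub>R (M *v e) + t *\<^sub>R (M *v f)"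
      and st: "s \<in> {0..1}" "t \<in> {0..1}" by blast
    have "w = M *v (o' + s *\<^sub>R e + t *\<^sub>R f)"
      unfolding w by (simp add: matrix_vector_right_distrib matrix_vector_mult_scaleR)
    then have "matrix_inv M *v w = o' + s *\<^sub>R e + t *\<^sub>R f"
      using inv by (simp add: matrix_inv_vector_mult_cancel)
    moreover have "\<bar>- c + x * (2 * c)\<bar> \<le> c" if "x \<in> {0..1}" "c > 0" for x c :: real
      using that mult_left_le[of x c] by (auto simp: abs_le_iff mult.commute)
    ultimately show "w \<in> U_set l \<Delta> vbar \<omega>bar \<eta>"
      using st assms by (simp add: mem_U_set_iff_matrix_inv o'_def e_def f_def flip: M_def)
  qed
  moreover have "independent {M *v e, M *v f}"
    using linear_independent_injective_image[OF matrix_vector_mul_linear ind inj_on_subset[OF inj]]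
    by simp
  moreover have "M *v e \<noteq> M *v f"
    using inj \<open>e \<noteq> f\<close> by (auto dest: injD)
  ultimately show ?thesis
    unfolding parallelogram_def convex_hull_parallelogram by blast
qed

text \<open>Makes precise that the parallelogram varies with \<open>\<eta>\<close>.\<close>

lemma U_set_not_constant:
  assumes "l > 0" "\<Delta> > 0" "vbar > 0" "\<omega>bar > 0"
  shows "\<not> U_set l \<Delta> vbar \<omega>bar constant_on eta_dom"
proof
  assume "U_set l \<Delta> vbar \<omega>bar constant_on eta_dom"
  \<comment> \<open>At \<open>\<eta>\<close> the frame is unrotated and
    \<open>cos (pi/3) = 1/2\<close> allows a first coordinate of exactly \<open>2 * vbar\<close>;
    the second coordinate of \<open>w\<close> makes the steering rate vanish. At
    \<open>\<xi>\<close> the first coordinate is bounded by \<open>vbar\<close>.\<close>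
  define \<eta> \<xi> w :: "real^2" where "\<eta> = vector [- (pi/3), pi/3]" and "\<xi> = vector [0, 0]"
    and "w = vector [2 * vbar, 2 * vbar * \<Delta> * sin (pi/3) / l]"
  have "\<eta> \<in> eta_dom" "\<xi> \<in> eta_dom"
    \<comment> \<open>Multiplied by 3, the bound \<open>-(pi/2) < pi/3\<close> becomes
      \<open>-(pi * 3 / 2) < pi\<close>.\<close>
    using less_trans[OF _ pi_gt_zero, of "- (pi * 3 / 2)"] by (auto simp: eta_dom_def \<eta>_def \<xi>_def)
  moreover from this have "w \<in> U_set l \<Delta> vbar \<omega>bar \<eta>" "w \<notin> U_set l \<Delta> vbar \<omega>bar \<xi>"
    using assms by (simp_all add: mem_U_set_iff \<eta>_def \<xi>_def w_def cos_60)
  ultimately show False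
    using \<open>U_set l \<Delta> vbar \<omega>bar constant_on eta_dom\<close> unfolding constant_on_def by metis
qed

section \<open>The intersection is a disc\<close>

text \<open>If \<open>w\<close> has polar angle \<beta> and \<open>(c, d)\<close> has polar angle
  \<gamma>, the frame turned by \<beta> - \<gamma> sees \<open>w\<close> in direction
  \<open>(c, d)\<close>. This serves to align a fixed \<open>w\<close> with the normal of a
  strip.\<close>

lemma rotation_to_direction:
  fixes w :: "real^2" and c d :: real
  assumes "c\<^sup>2 + d\<^sup>2 = 1"
  obtains \<alpha> where "cos \<alpha> * w$1 + sin \<alpha> * w$2 = norm w * c"
    "cos \<alpha> * w$2 - sin \<alpha> * w$1 = norm w * d"
proof -
  obtain \<gamma> where \<gamma>: "c = cos \<gamma>" "d = sin \<gamma>"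
    using sincos_total_2pi[OF assms] by metis
  obtain \<beta> where \<beta>: "w$1 = norm w * cos \<beta>" "w$2 = norm w * sin \<beta>"
  proof (cases "w = 0")
    case False
    have "(w$1 / norm w)\<^sup>2 + (w$2 / norm w)\<^sup>2 = (norm w)\<^sup>2 / (norm w)\<^sup>2"
      by (simp only: power_divide power2_norm_vec2 add_divide_distrib)
    then have "(w$1 / norm w)\<^sup>2 + (w$2 / norm w)\<^sup>2 = 1"
      using False by simp
    then obtain \<beta> where "w$1 / norm w = cos \<beta>" "w$2 / norm w = sin \<beta>"
      using sincos_total_2pi by metis
    then show ?thesis
      using False by (intro that[of \<beta>]) (simp_all add: field_simps)
  qed (use that in simp)
  have r: "cos \<beta> * cos \<beta> + sin \<beta> * sin \<beta> = 1"
    using sin_cos_squared_add[of \<beta>] by (simp add: power2_eq_square)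
  have "cos (\<beta> - \<gamma>) * w$1 + sin (\<beta> - \<gamma>) * w$2
      = norm w * (cos \<gamma> * (cos \<beta> * cos \<beta> + sin \<beta> * sin \<beta>))"
    unfolding \<beta> cos_diff sin_diff by (simp only: algebra_simps)
  moreover have "cos (\<beta> - \<gamma>) * w$2 - sin (\<beta> - \<gamma>) * w$1
      = norm w * (sin \<gamma> * (cos \<beta> * cos \<beta> + sin \<beta> * sin \<beta>))"
    unfolding \<beta> cos_diff sin_diff by (simp only: algebra_simps)
  ultimately show ?thesis
    by (intro that[of "\<beta> - \<gamma>"]) (simp_all add: \<gamma> r)
qed

lemma norm_le_if_mem_Inter_U_set:
  assumes "l > 0" "\<Delta> > 0" and w: "\<And>\<eta>. \<eta> \<in> eta_dom \<Longrightarrow> w \<in> U_set l \<Delta> vbar \<omega>bar \<eta>"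
  shows "norm w \<le> vbar" "norm w \<le> \<Delta> * l * \<omega>bar / sqrt (\<Delta>\<^sup>2 + l\<^sup>2)"
proof -
  \<comment> \<open>The velocity strip is narrowest at steering angle 0, with its normal along the
    frame.\<close>
  obtain \<alpha> where \<alpha>: "cos \<alpha> * w$1 + sin \<alpha> * w$2 = norm w"
    using rotation_to_direction[of 1 0 w] by auto
  have "vector [\<alpha>, 0] \<in> eta_dom"
    by (simp add: eta_dom_def)
  with w[OF this] show "norm w \<le> vbar"
    using assms(2) \<alpha> by (simp add: mem_U_set_iff)
  define K where "K = sqrt (\<Delta>\<^sup>2 + l\<^sup>2)"
  have K: "K > 0" "K * K = \<Delta> * \<Delta> + l * l"
    using assms(1,2) by (auto simp: K_def power2_eq_square intro!: add_pos_pos)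
  \<comment> \<open>For \<open>sin \<phi> = 1\<close> the steering strip has normal
    \<open>(- 1 / l, 1 / \<Delta>)\<close> in the frame; \<open>(- \<Delta> / K, l / K)\<close> is
    its unit vector.\<close>
  have "(- (\<Delta> / K))\<^sup>2 + (l / K)\<^sup>2 = (\<Delta> * \<Delta> + l * l) / (K * K)"
    by (simp add: power2_eq_square add_divide_distrib)
  then have "(- (\<Delta> / K))\<^sup>2 + (l / K)\<^sup>2 = 1"
    using K(1) by (simp flip: K(2))
  then obtain \<alpha> where \<alpha>: "cos \<alpha> * w$1 + sin \<alpha> * w$2 = norm w * - (\<Delta> / K)"
    "cos \<alpha> * w$2 - sin \<alpha> * w$1 = norm w * (l / K)"
    by (rule rotation_to_direction)
  have bound: "norm w * (l / K) / \<Delta> + sin \<phi> / l * (norm w * (\<Delta> / K)) \<le> \<omega>bar"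
    if "\<phi> \<in> {-(pi/2)<..<pi/2}" for \<phi>
  proof -
    \<comment> \<open>The heading compensates for \<phi>, so the frame angle stays \<alpha> while
      \<phi> varies.\<close>
    have "vector [\<alpha> - \<phi>, \<phi>] \<in> eta_dom"
      using that by (simp add: eta_dom_def)
    with w[OF this] show ?thesis
      using assms(2) \<alpha> by (simp add: mem_U_set_iff abs_le_iff)
  qed
  \<comment> \<open>The angle \<open>pi/2\<close> lies outside the domain, but the non-strict bound
    survives the limit from the left.\<close>
  have "((\<lambda>\<phi>. norm w * (l / K) / \<Delta> + sin \<phi> / l * (norm w * (\<Delta> / K)))
      \<longlongrightarrow> norm w * (l / K) / \<Delta> + sin (pi/2) / l * (norm w * (\<Delta> / K))) (at_left (pi/2))"
    using assms(1,2) K(1) by (intro tendsto_intros) simp_all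
  moreover have "\<forall>\<^sub>F \<phi> in at_left (pi/2).
      norm w * (l / K) / \<Delta> + sin \<phi> / l * (norm w * (\<Delta> / K)) \<le> \<omega>bar"
    using eventually_at_left_real[of "-(pi/2)" "pi/2"]
    by (rule eventually_mono) (simp_all only: bound, simp)
  ultimately have "norm w * (l / K) / \<Delta> + sin (pi/2) / l * (norm w * (\<Delta> / K)) \<le> \<omega>bar"
    by (rule tendsto_upperbound) simp
  also have "norm w * (l / K) / \<Delta> + sin (pi/2) / l * (norm w * (\<Delta> / K))
      = norm w * (\<Delta> * \<Delta> + l * l) / (K * \<Delta> * l)"
    using K(1) assms(1,2) by (simp add: field_simps)
  also have "\<dots> = norm w * K / (\<Delta> * l)"
    using K(1) by (simp flip: K(2))
  finally show "norm w \<le> \<Delta> * l * \<omega>bar / sqrt (\<Delta>\<^sup>2 + l\<^sup>2)"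
    using K(1) assms(1,2) by (simp add: field_simps flip: K_def)
qed

text \<open>Each constraint is a linear form in the rotated coordinates \<open>p\<close>,
  \<open>q\<close> of \<open>w\<close>, so it is at most \<open>norm w\<close> times the norm of its
  coefficients, which is bounded uniformly in \<open>\<eta>\<close>.\<close>

lemma mem_U_set_if_norm_le:
  assumes "l > 0" "\<Delta> > 0" "\<eta> \<in> eta_dom"
    and v: "norm w \<le> vbar" and \<omega>: "norm w \<le> \<Delta> * l * \<omega>bar / sqrt (\<Delta>\<^sup>2 + l\<^sup>2)"
  shows "w \<in> U_set l \<Delta> vbar \<omega>bar \<eta>"
proof -
  define \<alpha> where "\<alpha> = \<eta>$1 + \<eta>$2"
  define s where "s = sin (\<eta>$2)"
  define p where "p = cos \<alpha> * w$1 + sin \<alpha> * w$2"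
  define q where "q = cos \<alpha> * w$2 - sin \<alpha> * w$1"
  define K where "K = sqrt (\<Delta>\<^sup>2 + l\<^sup>2)"
  have K: "K > 0" "K\<^sup>2 = \<Delta>\<^sup>2 + l\<^sup>2"
    using assms(1,2) by (auto simp: K_def intro!: add_pos_pos)
  have "p\<^sup>2 + q\<^sup>2 = ((cos \<alpha>)\<^sup>2 + (sin \<alpha>)\<^sup>2) * ((w$1)\<^sup>2 + (w$2)\<^sup>2)"
    by (simp only: p_def q_def power2_eq_square algebra_simps)
  also have "\<dots> = (norm w)\<^sup>2"
    by (simp add: power2_norm_vec2)
  finally have pq: "p\<^sup>2 + q\<^sup>2 = (norm w)\<^sup>2" .
  then have "\<bar>p\<bar> \<le> norm w"
    by (metis abs_le_square_iff abs_norm_cancel le_add_same_cancel1 zero_le_power2)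
  then have "\<bar>cos (\<eta>$2) * p\<bar> \<le> vbar"
    using v mult_mono[OF abs_cos_le_one[of "\<eta>$2"], of "\<bar>p\<bar>" vbar] by (simp add: abs_mult)
  moreover have "\<bar>q / \<Delta> - s / l * p\<bar> \<le> \<omega>bar"
  proof -
    \<comment> \<open>Lagrange's identity: dropping the second square leaves the Cauchy-Schwarz
      inequality.\<close>
    have "(q / \<Delta> - s / l * p)\<^sup>2 + (q * s / l + p / \<Delta>)\<^sup>2 = (p\<^sup>2 + q\<^sup>2) * (1 / \<Delta>\<^sup>2 + s\<^sup>2 / l\<^sup>2)"
      by (simp add: power2_eq_square algebra_simps add_divide_distrib)
    then have "(q / \<Delta> - s / l * p)\<^sup>2 \<le> (norm w)\<^sup>2 * (1 / \<Delta>\<^sup>2 + s\<^sup>2 / l\<^sup>2)"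
      unfolding pq using zero_le_power2[of "q * s / l + p / \<Delta>"] by linarith
    also have "\<dots> \<le> (norm w)\<^sup>2 * (1 / \<Delta>\<^sup>2 + 1 / l\<^sup>2)"
      by (intro mult_left_mono add_left_mono divide_right_mono)
        (simp_all add: s_def abs_square_le_1)
    also have "\<dots> = (norm w)\<^sup>2 * K\<^sup>2 / (\<Delta> * l)\<^sup>2"
      unfolding K(2) using assms(1,2) by (simp add: field_simps)
    also have "\<dots> = (norm w * K / (\<Delta> * l))\<^sup>2"
      by (simp add: power_divide power_mult_distrib)
    finally have "\<bar>q / \<Delta> - s / l * p\<bar> \<le> norm w * K / (\<Delta> * l)"
      using K(1) assms(1,2) by (simp add: abs_le_square_iff[symmetric])
    also have "\<dots> \<le> \<omega>bar"
      using \<omega> K(1) assms(1,2) by (simp add: field_simps flip: K_def)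
    finally show ?thesis .
  qed
  ultimately show ?thesis
    using assms(2,3) by (simp add: mem_U_set_iff p_def q_def s_def \<alpha>_def)
qed

theorem lemma2:
  fixes l \<Delta> vbar \<omega>bar :: real
  assumes "l > 0" and "\<Delta> > 0" and "vbar > 0" and "\<omega>bar > 0"
  shows "(\<forall>\<eta>\<in>eta_dom. polyhedron (U_set l \<Delta> vbar \<omega>bar \<eta>) \<and>
            parallelogram (U_set l \<Delta> vbar \<omega>bar \<eta>)) \<and>
         \<not> (U_set l \<Delta> vbar \<omega>bar) constant_on eta_dom \<and>
         (\<Inter>\<eta>\<in>eta_dom. U_set l \<Delta> vbar \<omega>bar \<eta>) =
           {w. w \<bullet> w \<le> (min (\<Delta> * l * \<omega>bar / sqrt (\<Delta>^2 + l^2)) vbar)^2}"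
proof (intro conjI ballI)
  fix \<eta> :: "real^2" assume "\<eta> \<in> eta_dom"
  then show "parallelogram (U_set l \<Delta> vbar \<omega>bar \<eta>)"
    using assms by (simp add: parallelogram_U_set)
  then show "polyhedron (U_set l \<Delta> vbar \<omega>bar \<eta>)"
    by (rule parallelogram_imp_polyhedron)
next
  show "\<not> (U_set l \<Delta> vbar \<omega>bar) constant_on eta_dom"
    using assms by (rule U_set_not_constant)
next
  let ?r = "min (\<Delta> * l * \<omega>bar / sqrt (\<Delta>^2 + l^2)) vbar"
  \<comment> \<open>Comparing squares amounts to comparing the norm with the radius only for a
    nonnegative radius.\<close>
  have "0 \<le> ?r"
    using assms by simp
  then have disc: "w \<bullet> w \<le> ?r\<^sup>2 \<longleftrightarrow> norm w \<le> ?r" for w :: "real^2"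
    by (simp only: norm_le_square simp_thms)
  show "(\<Inter>\<eta>\<in>eta_dom. U_set l \<Delta> vbar \<omega>bar \<eta>) = {w. w \<bullet> w \<le> ?r\<^sup>2}"
    unfolding disc min.bounded_iff
    by (blast intro: norm_le_if_mem_Inter_U_set[OF assms(1,2)] mem_U_set_if_norm_le[OF assms(1,2)])
qed

end
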